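(* Let $\rho$ be a critical radius function on $\mathbb{R}^d$, and let $T$ be an operator such that for some Young function $\phi$ and for all $\theta\ge0$ there exists a constant $C$ such that $$w(\{|Tf|>\lambda\})\le\frac{C}{\lambda}\int|f|\,M_\phi^\theta w\qquad\text{for all }\lambda>0$$ for every weight $w$ (and any function $f$ in the domain of $T$). Then, if a function $f$ satisfies $$\int_{\mathbb{R}^d}\frac{|f(x)|}{(1+|x|)^\sigma}\,dx<\infty\quad\text{for some }\sigma>0,$$ one has $Tf\in L^{1,\infty}_{\mathrm{loc}}(\mathbb{R}^d)$. In particular $Tf$ is finite almost everywhere.
   Context: A weight is a function $w\ge0$ in $L^1_{\mathrm{loc}}(\mathbb{R}^d)$, and $w(E)=\int_Ew$. $T$ maps measurable functions in its domain to measurable functions, and the functions $f$ in the statement are taken in that domain. $g\in L^{1,\infty}_{\mathrm{loc}}$ means $\sup_{\lambda>0}\lambda\,|\{x\in B:|g(x)|>\lambda\}|<\infty$ for every ball $B$. A critical radius function is a function $\rho:\mathbb{R}^d\to(0,\infty)$ for which there are constants $C_0,N_0\ge1$ such that for all $x,y$ $$C_0^{-1}\rho(x)\left(1+\tfrac{|x-y|}{\rho(x)}\right)^{-N_0}\le\rho(y)\le C_0\,\rho(x)\left(1+\tfrac{|x-y|}{\rho(x)}\right)^{\frac{N_0}{N_0+1}}.$$ A Young function is a continuous, convex, increasing $\phi:[0,\infty)\to[0,\infty)$ with $\phi(0)=0$. For a ball $B$, $\|f\|_{\phi,B}=\inf\{\lambda>0:\frac1{|B|}\int_B\phi(|f|/\lambda)\le1\}$,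 and for $\theta\ge0$ $$M_\phi^\theta f(x)=\sup_{B(x_0,r_0)\ni x}\left(1+\frac{r_0}{\rho(x_0)}\right)^{-\theta}\|f\|_{\phi,B(x_0,r_0)}.$$ *)

theory Defs
  imports "HOL-Analysis.Analysis"
begin

definition critical_radius :: "('a::euclidean_space \<Rightarrow> real) \<Rightarrow> bool" where
  "critical_radius \<rho> \<longleftrightarrow>
     (\<forall>x. 0 < \<rho> x) \<and>
     (\<exists>C0 N0::real. 1 \<le> C0 \<and> 1 \<le> N0 \<and>
       (\<forall>x y. inverse C0 * \<rho> x * (1 + norm (x - y) / \<rho> x) powr (- N0) \<le> \<rho> y \<and>
              \<rho> y \<le> C0 * \<rho> x * (1 + norm (x - y) / \<rho> x) powr (N0 / (N0 + 1))))"

text \<open>``Increasing'' is read in the wide sense, so that for instance \<open>max 0 (t - 1)\<close> is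
  a Young function. Only the values on the half-line \<open>{0..}\<close> matter.\<close>

definition young_function :: "(real \<Rightarrow> real) \<Rightarrow> bool" where
  "young_function \<phi> \<longleftrightarrow>
     \<phi> \<in> {0..} \<rightarrow> {0..} \<and> continuous_on {0..} \<phi> \<and> convex_on {0..} \<phi> \<and>
     mono_on {0..} \<phi> \<and> \<phi> 0 = 0"

definition weight :: "('a::euclidean_space \<Rightarrow> real) \<Rightarrow> bool" where
  "weight w \<longleftrightarrow>
     w \<in> borel_measurable lebesgue \<and> (\<forall>x. 0 \<le> w x) \<and>
     (\<forall>K. compact K \<longrightarrow> set_integrable lebesgue K w)"

definition weight_measure :: "('a::euclidean_space \<Rightarrow> real) \<Rightarrow> 'a set \<Rightarrow> ennreal" where
  "weight_measure w E = (\<integral>\<^sup>+x\<in>E. ennreal (w x) \<partial>lebesgue)"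

text \<open>The Luxemburg average takes values in \<open>[0, \<infinity>]\<close>; the infimum of the empty set
  is \<open>\<infinity>\<close>.\<close>

definition luxemburg :: "(real \<Rightarrow> real) \<Rightarrow> ('a::euclidean_space \<Rightarrow> real) \<Rightarrow> 'a set \<Rightarrow> ennreal" where
  "luxemburg \<phi> f B =
     Inf {ennreal l | l. 0 < l \<and>
       (\<integral>\<^sup>+x\<in>B. ennreal (\<phi> (\<bar>f x\<bar> / l)) \<partial>lebesgue) / emeasure lebesgue B \<le> 1}"

definition maximal ::
  "('a::euclidean_space \<Rightarrow> real) \<Rightarrow> (real \<Rightarrow> real) \<Rightarrow> real \<Rightarrow> ('a \<Rightarrow> real) \<Rightarrow> 'a \<Rightarrow> ennreal" where
  "maximal \<rho> \<phi> \<theta> f x =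
     (SUP (x0, r0) \<in> {(x0, r0). 0 < r0 \<and> x \<in> ball x0 r0}.
        ennreal ((1 + r0 / \<rho> x0) powr (- \<theta>)) * luxemburg \<phi> f (ball x0 r0))"

definition weak_L1_loc :: "('a::euclidean_space \<Rightarrow> ereal) \<Rightarrow> bool" where
  "weak_L1_loc g \<longleftrightarrow>
     g \<in> borel_measurable lebesgue \<and>
     (\<forall>c r. (SUP l \<in> {0<..}. ennreal l * emeasure lebesgue {x \<in> ball c r. ereal l < \<bar>g x\<bar>}) < \<infinity>)"

end

theory Submission
  imports Defs
begin

text \<open>Test the hypothesis on the indicator \<open>w\<close> of a ball \<open>B(0, R)\<close>. The Luxemburg
  averages of \<open>w\<close> are bounded, and they vanish on balls not meeting \<open>B(0, R)\<close>. A ball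
  \<open>B(x0, r0)\<close> which contains \<open>x\<close> and meets \<open>B(0, R)\<close> has \<open>r0\<close> of size at least
  \<open>(\<bar>x\<bar> - R) / 2\<close>, while \<open>\<rho>(x0)\<close> grows at most like \<open>r0\<close> to the power
  \<open>N0 / (N0 + 1) < 1\<close>; so the factor \<open>(1 + r0 / \<rho>(x0)) powr (- \<theta>)\<close> decays like
  \<open>(1 + \<bar>x\<bar>) powr (- \<sigma>)\<close> for \<open>\<theta> = (N0 + 1) \<sigma>\<close>. Hence \<open>\<integral>\<bar>f\<bar> M w\<close> is finite.\<close>

section \<open>Luxemburg averages of bounded functions\<close>

lemma luxemburg_eq_0:
  assumes "\<phi> 0 = 0" and "\<And>x. x \<in> B \<Longrightarrow> f x = 0"
  shows "luxemburg \<phi> f B = 0"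
proof -
  have "(\<integral>\<^sup>+x\<in>B. ennreal (\<phi> (\<bar>f x\<bar> / l)) \<partial>lebesgue) = 0" for l
    using assms by (subst nn_integral_cong[where v = "\<lambda>_. 0"]) (auto split: split_indicator)
  then have "luxemburg \<phi> f B \<le> ennreal l" if "0 < l" for l
    unfolding luxemburg_def using that by (intro Inf_lower) auto
  then have "luxemburg \<phi> f B \<le> 0 + ennreal l" if "0 < l" for l
    using that by simp
  then have "luxemburg \<phi> f B \<le> 0"
    using ennreal_le_epsilon by blast
  then show ?thesis by simp
qed

text \<open>Monotonicity of \<phi> keeps the integrand below \<open>\<phi> (1 / k)\<close>, so
  \<open>k\<close> competes in the infimum. The bound is the same for every \<open>B\<close>, as a
  supremum over balls requires.\<close>

lemma luxemburg_le:
  assumes \<phi>: "young_function \<phi>" and k: "0 < k" "\<phi> (1 / k) \<le> 1"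
    and f: "\<And>x. \<bar>f x\<bar> \<le> 1"
    and B: "B \<in> sets lebesgue" "emeasure lebesgue B \<noteq> 0" "emeasure lebesgue B \<noteq> \<infinity>"
  shows "luxemburg \<phi> f B \<le> ennreal k"
proof -
  have "\<phi> (\<bar>f x\<bar> / k) \<le> 1" for x
  proof -
    have "\<phi> (\<bar>f x\<bar> / k) \<le> \<phi> (1 / k)"
      using \<phi> k f[of x] unfolding young_function_def
      by (auto intro!: mono_onD[of "{0..}" \<phi>] divide_right_mono)
    with k show ?thesis by linarith
  qed
  then have "(\<integral>\<^sup>+x\<in>B. ennreal (\<phi> (\<bar>f x\<bar> / k)) \<partial>lebesgue) \<le> (\<integral>\<^sup>+x. indicator B x \<partial>lebesgue)"
    by (intro nn_integral_mono) (auto split: split_indicator)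
  also have "\<dots> = emeasure lebesgue B" using B by simp
  finally have "(\<integral>\<^sup>+x\<in>B. ennreal (\<phi> (\<bar>f x\<bar> / k)) \<partial>lebesgue) / emeasure lebesgue B
      \<le> emeasure lebesgue B / emeasure lebesgue B"
    by (rule divide_right_mono_ennreal)
  also have "\<dots> = 1" using B by (simp add: ennreal_divide_self less_top)
  finally show ?thesis
    unfolding luxemburg_def using k by (intro Inf_lower) auto
qed

lemma young_function_le_1:
  assumes "young_function \<phi>"
  obtains k where "0 < k" "\<phi> (1 / k) \<le> 1"
proof -
  have "continuous_on {0..} \<phi>" "\<phi> 0 = 0" using assms by (auto simp: young_function_def)
  then obtain d where d: "d > 0" "\<And>t. t \<ge> 0 \<Longrightarrow> dist t 0 < d \<Longrightarrow> dist (\<phi> t) (\<phi> 0) < 1"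
    unfolding continuous_on_iff by (metis atLeast_iff order_refl zero_less_one)
  then have "\<bar>\<phi> (d / 2)\<bar> < 1" using d(2)[of "d / 2"] \<open>\<phi> 0 = 0\<close> by (auto simp: dist_real_def)
  \<comment> \<open>With \<open>k = 2 / d\<close> the argument \<open>1 / k\<close> is
    \<open>d / 2\<close>, which lies inside the neighbourhood of 0 where \<phi> stays below
    1.\<close>
  then show thesis using d(1) by (intro that[of "2 / d"]) auto
qed

section \<open>Growth of the critical radius and decay of the maximal function\<close>

text \<open>Comparing \<open>x0\<close> with the origin bounds \<open>\<rho> x0\<close> by a
  multiple of \<open>(1 + r) powr b\<close> with \<open>b < 1\<close>, so
  \<open>r / \<rho> x0\<close> still grows like a power of \<open>r\<close>. The constant
  \<open>A\<close> may depend on \<open>R\<close> but \<open>N\<close> does not, so that one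
  \<theta> will serve all balls.\<close>

lemma critical_radius_growth:
  fixes \<rho> :: "'a::euclidean_space \<Rightarrow> real"
  assumes "critical_radius \<rho>"
  obtains N where "0 < N"
    "\<And>R. 0 \<le> R \<Longrightarrow> \<exists>A>0. \<forall>x0 r. 0 < r \<longrightarrow> norm x0 \<le> R + r \<longrightarrow> 1 + r \<le> A * (1 + r / \<rho> x0) powr N"
proof -
  from assms obtain C N :: real where pos: "\<And>x. 0 < \<rho> x" and C: "1 \<le> C" "1 \<le> N"
    and upper: "\<And>x y. \<rho> y \<le> C * \<rho> x * (1 + norm (x - y) / \<rho> x) powr (N / (N + 1))"
    unfolding critical_radius_def by blast
  define b where "b = N / (N + 1)"
  have b: "0 \<le> b" "1 - b = 1 / (N + 1)" using C by (auto simp: b_def field_simps)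
  have "\<exists>A>0. \<forall>x0 r. 0 < r \<longrightarrow> norm x0 \<le> R + r \<longrightarrow> 1 + r \<le> A * (1 + r / \<rho> x0) powr (N + 1)"
    if R: "0 \<le> R" for R
  proof -
    define p where "p = \<rho> 0"
    have p: "0 < p" using pos by (simp add: p_def)
    \<comment> \<open>Chosen so that \<open>1 + (R + r) / p\<close> is at most
      \<open>L * (1 + r)\<close>.\<close>
    define L where "L = 1 + R / p + 1 / p"
    have L: "0 < L" using p R by (auto simp: L_def intro!: add_pos_nonneg)
    \<comment> \<open>The maximum with 1 lets \<open>K\<close> also absorb the summand 1 in the
      lower bound for \<open>1 + r / \<rho> x0\<close> below.\<close>
    define K where "K = max 1 (C * p * L powr b)"
    have K: "1 \<le> K" by (simp add: K_def)
    have "1 + r \<le> K powr (N + 1) * (1 + r / \<rho> x0) powr (N + 1)"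
      if r: "0 < r" "norm x0 \<le> R + r" for x0 r
    proof -
      have "norm x0 / p \<le> (R + r) / p"
        using r p by (intro divide_right_mono) auto
      also have "1 + (R + r) / p \<le> L * (1 + r)"
        using r p R by (simp add: L_def field_simps)
      finally have *: "1 + norm x0 / p \<le> L * (1 + r)" by simp
      have "\<rho> x0 \<le> C * p * (1 + norm x0 / p) powr b"
        using upper[of x0 0] by (simp add: p_def b_def)
      also have "\<dots> \<le> C * p * (L * (1 + r)) powr b"
        using * p C b by (intro mult_left_mono powr_mono2) auto
      also have "\<dots> = C * p * L powr b * (1 + r) powr b"
        using L r by (simp add: powr_mult)
      also have "\<dots> \<le> K * (1 + r) powr b"
        by (intro mult_right_mono) (auto simp: K_def)
      finally have \<rho>: "\<rho> x0 \<le> K * (1 + r) powr b" .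
      have ge1: "1 \<le> (1 + r) powr b" using r b by (intro ge_one_powr_ge_zero) auto
      \<comment> \<open>Splitting off the summand 1 leaves \<open>r / (1 + r) powr b\<close>.
        Inserting \<open>K\<close> above and below makes the denominator the upper bound for
        \<open>\<rho> x0\<close>.\<close>
      have "(1 + r) powr (1 - b) = (1 + r) / (1 + r) powr b"
        using r by (simp add: powr_diff)
      also have "\<dots> \<le> 1 + r / (1 + r) powr b"
        using ge1 by (simp add: add_divide_distrib divide_le_eq)
      also have "\<dots> \<le> K + K * r / (K * (1 + r) powr b)" using K by simp
      also have "\<dots> \<le> K + K * r / \<rho> x0"
        using \<rho> pos[of x0] K r by (intro add_left_mono divide_left_mono) auto
      finally have "(1 + r) powr (1 / (N + 1)) \<le> K * (1 + r / \<rho> x0)"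
        using b by (simp add: algebra_simps)
      \<comment> \<open>Since \<open>1 - b\<close> is \<open>1 / (N + 1)\<close>, the power
        \<open>N + 1\<close> recovers \<open>1 + r\<close>.\<close>
      then have "((1 + r) powr (1 / (N + 1))) powr (N + 1) \<le> (K * (1 + r / \<rho> x0)) powr (N + 1)"
        using C by (intro powr_mono2) auto
      also have "((1 + r) powr (1 / (N + 1))) powr (N + 1) = 1 + r"
        using r C by (simp add: powr_powr)
      finally show ?thesis using K r pos[of x0] by (simp add: powr_mult)
    qed
    then show ?thesis using K by (intro exI[of _ "K powr (N + 1)"]) auto
  qed
  with C show thesis by (intro that[of "N + 1"]) auto
qed

text \<open>The rate \<sigma> is dictated by the integrability of \<open>f\<close>. The choice
  \<open>\<theta> = N * \<sigma>\<close> turns the growth estimate, raised to the power \<sigma>,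
  into this decay.\<close>

lemma maximal_indicator_ball_decay:
  fixes \<rho> :: "'a::euclidean_space \<Rightarrow> real"
  assumes \<rho>: "critical_radius \<rho>" and \<phi>: "young_function \<phi>" and \<sigma>: "0 < \<sigma>"
  obtains \<theta> where "0 \<le> \<theta>"
    "\<And>R. 0 \<le> R \<Longrightarrow> \<exists>K>0. \<forall>x. maximal \<rho> \<phi> \<theta> (indicator (ball 0 R)) x \<le> ennreal (K / (1 + norm x) powr \<sigma>)"
proof -
  obtain N where N: "0 < N"
    and growth: "\<And>R. 0 \<le> R \<Longrightarrow> \<exists>A>0. \<forall>x0 r. 0 < r \<longrightarrow> norm x0 \<le> R + r \<longrightarrow> 1 + r \<le> A * (1 + r / \<rho> x0) powr N"
    using critical_radius_growth[OF \<rho>] by blast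
  obtain k where k: "0 < k" "\<phi> (1 / k) \<le> 1" using young_function_le_1[OF \<phi>] .
  have pos: "\<And>x. 0 < \<rho> x" using \<rho> by (auto simp: critical_radius_def)
  have "\<exists>K>0. \<forall>x. maximal \<rho> \<phi> (N * \<sigma>) (indicator (ball 0 R)) x \<le> ennreal (K / (1 + norm x) powr \<sigma>)"
    if R: "0 \<le> R" for R
  proof -
    obtain A where A: "0 < A" and A': "\<And>x0 r. 0 < r \<Longrightarrow> norm x0 \<le> R + r \<Longrightarrow> 1 + r \<le> A * (1 + r / \<rho> x0) powr N"
      using growth[OF R] by blast
    \<comment> \<open>The factor \<open>k\<close> bounds the Luxemburg averages; the other factor
      comes from comparing \<open>1 + norm x\<close> with \<open>q powr N\<close>.\<close>
    define K where "K = ((2 + R) * A) powr \<sigma> * k"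
    have "ennreal ((1 + r / \<rho> x0) powr (- (N * \<sigma>))) * luxemburg \<phi> (indicator (ball 0 R)) (ball x0 r)
        \<le> ennreal (K / (1 + norm x) powr \<sigma>)"
      if r: "0 < r" "x \<in> ball x0 r" for x x0 r
    proof (cases "ball 0 R \<inter> ball x0 r = {}")
      case True
      then have "luxemburg \<phi> (indicator (ball 0 R)) (ball x0 r) = 0"
        using \<phi> by (intro luxemburg_eq_0) (auto simp: young_function_def indicator_def)
      then show ?thesis by simp
    next
      case False
      then obtain y where y: "norm y < R" "dist x0 y < r" by auto
      have x0: "norm x0 \<le> R + r"
        using y norm_triangle_sub[of x0 y] by (simp add: dist_norm)
      define q where "q = 1 + r / \<rho> x0"
      have q: "1 \<le> q" using r pos[of x0] by (simp add: q_def)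
      \<comment> \<open>As the ball contains \<open>x\<close> and its centre has norm at most
        \<open>R + r\<close>, the norm of \<open>x\<close> is at most
        \<open>R + 2 * r\<close>.\<close>
      have "1 + norm x \<le> 1 + R + 2 * r"
        using x0 r norm_triangle_sub[of x x0] by (simp add: dist_norm norm_minus_commute)
      also have "\<dots> \<le> (2 + R) * (1 + r)" using R r by (simp add: algebra_simps)
      also have "\<dots> \<le> (2 + R) * (A * q powr N)"
        unfolding q_def using R A'[OF r(1) x0] by (intro mult_left_mono) auto
      finally have "(1 + norm x) powr \<sigma> \<le> ((2 + R) * A * q powr N) powr \<sigma>"
        using \<sigma> by (intro powr_mono2) (auto simp: mult.assoc)
      also have "\<dots> = ((2 + R) * A) powr \<sigma> * q powr (N * \<sigma>)"
        using R A by (simp add: powr_mult powr_powr)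
      finally have *: "(1 + norm x) powr \<sigma> \<le> ((2 + R) * A) powr \<sigma> * q powr (N * \<sigma>)" .
      have xpos: "0 < (1 + norm x) powr \<sigma>"
        using norm_ge_zero[of x] by (simp del: norm_ge_zero)
      have "q powr (- (N * \<sigma>)) = 1 / q powr (N * \<sigma>)" by (simp add: powr_minus_divide)
      also have "\<dots> \<le> ((2 + R) * A) powr \<sigma> / (1 + norm x) powr \<sigma>"
        using * q xpos by (simp add: field_simps)
      finally have "q powr (- (N * \<sigma>)) * k \<le> ((2 + R) * A) powr \<sigma> / (1 + norm x) powr \<sigma> * k"
        using k by (intro mult_right_mono) auto
      then have "q powr (- (N * \<sigma>)) * k \<le> K / (1 + norm x) powr \<sigma>"
        by (simp add: K_def)
      moreover have "luxemburg \<phi> (indicator (ball 0 R)) (ball x0 r) \<le> ennreal k"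
        using r emeasure_lborel_ball_finite[of x0 r] content_ball_pos[OF r(1), of x0]
        by (intro luxemburg_le \<phi> k) (auto simp: indicator_def measure_def less_top)
      then have "ennreal (q powr (- (N * \<sigma>))) * luxemburg \<phi> (indicator (ball 0 R)) (ball x0 r)
          \<le> ennreal (q powr (- (N * \<sigma>)) * k)"
        using k by (auto simp: ennreal_mult intro!: mult_left_mono)
      ultimately show ?thesis
        unfolding q_def using ennreal_leI order_trans by blast
    qed
    moreover have "0 < K" using A R k by (simp add: K_def)
    ultimately show ?thesis
      unfolding maximal_def by (intro exI[of _ K] conjI allI SUP_least) auto
  qed
  with N \<sigma> show thesis by (intro that[of "N * \<sigma>"]) auto
qed

section \<open>Indicators of balls as weights\<close>

lemma weight_indicator_ball: "weight (indicator (ball c R) :: 'a::euclidean_space \<Rightarrow> real)"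
proof -
  have "set_integrable lebesgue K (indicator (ball c R) :: 'a \<Rightarrow> real)" if "compact K" for K
  proof -
    have "K \<inter> ball c R \<in> lmeasurable"
      by (intro fmeasurable.Int lmeasurable_compact[OF that] lmeasurable_ball)
    then have "integrable lebesgue (indicator (K \<inter> ball c R) :: 'a \<Rightarrow> real)"
      by (intro integrable_real_indicator) (simp_all only: fmeasurable_def mem_Collect_eq infinity_ennreal_def)
    then show ?thesis
      by (simp add: set_integrable_def indicator_inter_arith[symmetric])
  qed
  moreover have "(indicator (ball c R) :: 'a \<Rightarrow> real) \<in> borel_measurable lebesgue"
    by (intro borel_measurable_indicator) simp
  ultimately show ?thesis by (auto simp: weight_def)
qed

lemma weight_measure_indicator:
  assumes "A \<in> sets lebesgue" "E \<in> sets lebesgue"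
  shows "weight_measure (indicator A) E = emeasure lebesgue (A \<inter> E)"
proof -
  have "weight_measure (indicator A) E = (\<integral>\<^sup>+x. indicator (A \<inter> E) x \<partial>lebesgue)"
    unfolding weight_measure_def by (intro nn_integral_cong) (auto split: split_indicator)
  then show ?thesis using assms by simp
qed

section \<open>Local weak integrability and finiteness almost everywhere\<close>

text \<open>A general Borel set \<open>S\<close> covers both the superlevel sets and the set where
  \<open>g\<close> is infinite.\<close>

lemma sets_lebesgue_ball_abs_in:
  fixes g :: "'a::euclidean_space \<Rightarrow> ereal"
  assumes "g \<in> borel_measurable lebesgue" "S \<in> sets borel"
  shows "{x \<in> ball c r. \<bar>g x\<bar> \<in> S} \<in> sets lebesgue"
proof -
  have "(\<lambda>x. \<bar>g x\<bar>) \<in> borel_measurable lebesgue" using assms(1) by measurable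
  then have "(\<lambda>x. \<bar>g x\<bar>) -` S \<inter> space lebesgue \<in> sets lebesgue"
    using assms(2) by (rule measurable_sets)
  then have "ball c r \<inter> ((\<lambda>x. \<bar>g x\<bar>) -` S \<inter> space lebesgue) \<in> sets lebesgue"
    by (intro sets.Int) simp_all
  then show ?thesis by (simp add: Int_def)
qed

text \<open>Every ball lies in one centred at the origin, so the latter suffice, each with its own
  bound \<open>M\<close>.\<close>

lemma weak_L1_locI:
  fixes g :: "'a::euclidean_space \<Rightarrow> ereal"
  assumes g: "g \<in> borel_measurable lebesgue"
    and bd: "\<And>R. 0 \<le> R \<Longrightarrow> \<exists>M<\<infinity>. \<forall>l>0. ennreal l * emeasure lebesgue {x \<in> ball 0 R. ereal l < \<bar>g x\<bar>} \<le> M"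
  shows "weak_L1_loc g"
  unfolding weak_L1_loc_def
proof (intro conjI g allI)
  fix c :: 'a and r :: real
  \<comment> \<open>The absolute value keeps \<open>R\<close> nonnegative when \<open>r\<close> is
    negative and \<open>ball c r\<close> is empty.\<close>
  define R where "R = norm c + \<bar>r\<bar>"
  have sub: "ball c r \<subseteq> ball 0 R"
  proof
    fix x assume "x \<in> ball c r"
    then show "x \<in> ball 0 R"
      using norm_triangle_sub[of x c] by (simp add: R_def dist_norm norm_minus_commute)
  qed
  obtain M where M: "M < \<infinity>" "\<And>l. l > 0 \<Longrightarrow> ennreal l * emeasure lebesgue {x \<in> ball 0 R. ereal l < \<bar>g x\<bar>} \<le> M"
    using bd[of R] unfolding R_def by (metis abs_ge_zero add_nonneg_nonneg norm_ge_zero)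
  have "ennreal l * emeasure lebesgue {x \<in> ball c r. ereal l < \<bar>g x\<bar>} \<le> M" if "l > 0" for l
  proof -
    have meas: "{x \<in> ball 0 R. ereal l < \<bar>g x\<bar>} \<in> sets lebesgue"
      using sets_lebesgue_ball_abs_in[OF g, of "{ereal l<..}" 0 R] by simp
    have "ennreal l * emeasure lebesgue {x \<in> ball c r. ereal l < \<bar>g x\<bar>}
        \<le> ennreal l * emeasure lebesgue {x \<in> ball 0 R. ereal l < \<bar>g x\<bar>}"
      using sub meas by (intro mult_left_mono emeasure_mono) auto
    with M(2)[OF that] show ?thesis by order
  qed
  then show "(SUP l \<in> {0<..}. ennreal l * emeasure lebesgue {x \<in> ball c r. ereal l < \<bar>g x\<bar>}) < \<infinity>"
    using M(1) by (intro le_less_trans[OF SUP_least M(1)]) auto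
qed

text \<open>Within a ball, the set where \<open>g\<close> is infinite lies in every superlevel set,
  so all integer multiples of its measure share a finite bound and it is null. Countably many balls
  exhaust the space.\<close>

lemma weak_L1_loc_finite_AE:
  fixes g :: "'a::euclidean_space \<Rightarrow> ereal"
  assumes "weak_L1_loc g"
  shows "AE x in lebesgue. \<bar>g x\<bar> < \<infinity>"
proof -
  have g: "g \<in> borel_measurable lebesgue" using assms by (simp add: weak_L1_loc_def)
  have "AE x in lebesgue. \<not> (x \<in> ball 0 (real n) \<and> \<bar>g x\<bar> = \<infinity>)" for n :: nat
  proof -
    let ?S = "\<lambda>l. {x \<in> ball 0 (real n). ereal l < \<bar>g x\<bar>}"
    let ?E = "{x \<in> ball 0 (real n). \<bar>g x\<bar> = \<infinity>}"
    define M where "M = (SUP l \<in> {0<..}. ennreal l * emeasure lebesgue (?S l))"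
    have M: "M < \<infinity>" using assms unfolding M_def weak_L1_loc_def by blast
    have E: "?E \<in> sets lebesgue" using sets_lebesgue_ball_abs_in[OF g, of "{\<infinity>}" 0 "real n"] by simp
    have le: "ennreal (real m) * emeasure lebesgue ?E \<le> M" if "0 < m" for m
    proof -
      have "?S (real m) \<in> sets lebesgue"
        using sets_lebesgue_ball_abs_in[OF g, of "{ereal (real m)<..}" 0 "real n"] by simp
      then have "ennreal (real m) * emeasure lebesgue ?E \<le> ennreal (real m) * emeasure lebesgue (?S (real m))"
        by (intro mult_left_mono emeasure_mono) auto
      also have "\<dots> \<le> M" unfolding M_def using that by (intro SUP_upper) auto
      finally show ?thesis .
    qed
    have "emeasure lebesgue ?E = 0"
    proof (rule ccontr)
      assume ne: "emeasure lebesgue ?E \<noteq> 0"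
      have "M \<noteq> top" using M by simp
      with ne have "M / emeasure lebesgue ?E \<noteq> top"
        by (simp add: ennreal_divide_eq_top_iff)
      then obtain m :: nat where m: "M / emeasure lebesgue ?E < of_nat m"
        using ennreal_Ex_less_of_nat less_top by blast
      \<comment> \<open>Finiteness, read off from the bound with \<open>m = 1\<close>, allows
        clearing the denominator in the choice of \<open>m\<close>.\<close>
      have "emeasure lebesgue ?E < top"
        using le[of 1] M by (simp add: le_less_trans)
      then have "M < of_nat m * emeasure lebesgue ?E"
        using divide_less_ennreal[OF ne] m by blast
      moreover have "0 < m" using m by (cases m) simp_all
      ultimately show False using le[of m] by (simp add: ennreal_of_nat_eq_real_of_nat)
    qed
    then have "?E \<in> null_sets lebesgue" using E by (rule null_setsI)
    moreover have "{x \<in> space lebesgue. \<not> \<not> (x \<in> ball 0 (real n) \<and> \<bar>g x\<bar> = \<infinity>)} \<subseteq> ?E" by auto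
    ultimately show ?thesis by (rule AE_I')
  qed
  then have "AE x in lebesgue. \<forall>n::nat. \<not> (x \<in> ball 0 (real n) \<and> \<bar>g x\<bar> = \<infinity>)"
    by (intro AE_all_countable[THEN iffD2] allI)
  then show ?thesis
  proof eventually_elim
    case (elim x)
    obtain n :: nat where "norm x < real n" using reals_Archimedean2 by blast
    with elim show ?case by auto
  qed
qed

section \<open>Testing the weighted inequality on indicators of balls\<close>

theorem theorem11:
  fixes \<rho> :: "real ^ 'd \<Rightarrow> real"
    and D :: "(real ^ 'd \<Rightarrow> ereal) set"
    and T :: "(real ^ 'd \<Rightarrow> ereal) \<Rightarrow> real ^ 'd \<Rightarrow> ereal"
    and f :: "real ^ 'd \<Rightarrow> ereal"
  assumes "critical_radius \<rho>"
    and "D \<subseteq> borel_measurable lebesgue"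
    and "T \<in> D \<rightarrow> borel_measurable lebesgue"
    and "\<exists>\<phi>. young_function \<phi> \<and>
           (\<forall>\<theta>\<ge>0. \<exists>C>0. \<forall>w. weight w \<longrightarrow> (\<forall>g\<in>D. \<forall>l>0.
              weight_measure w {x. ereal l < \<bar>T g x\<bar>} \<le>
                ennreal (C / l) * (\<integral>\<^sup>+x. e2ennreal \<bar>g x\<bar> * maximal \<rho> \<phi> \<theta> w x \<partial>lebesgue)))"
    and "f \<in> D"
    and "\<exists>\<sigma>>0. (\<integral>\<^sup>+x. e2ennreal \<bar>f x\<bar> / ennreal ((1 + norm x) powr \<sigma>) \<partial>lebesgue) < \<infinity>"
  shows "weak_L1_loc (T f) \<and> (AE x in lebesgue. \<bar>T f x\<bar> < \<infinity>)"
proof -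
  note [measurable] = subsetD[OF assms(2,5)] funcset_mem[OF assms(3,5)]
  have [measurable]: "(norm :: real ^ 'd \<Rightarrow> real) \<in> borel_measurable lebesgue"
    by (intro measurable_completion) simp
  obtain \<phi> where \<phi>: "young_function \<phi>"
    and T: "\<And>\<theta>. 0 \<le> \<theta> \<Longrightarrow> \<exists>C>0. \<forall>w. weight w \<longrightarrow> (\<forall>g\<in>D. \<forall>l>0.
              weight_measure w {x. ereal l < \<bar>T g x\<bar>} \<le>
                ennreal (C / l) * (\<integral>\<^sup>+x. e2ennreal \<bar>g x\<bar> * maximal \<rho> \<phi> \<theta> w x \<partial>lebesgue))"
    using assms(4) by blast
  obtain \<sigma> where \<sigma>: "0 < \<sigma>"
    and fin: "(\<integral>\<^sup>+x. e2ennreal \<bar>f x\<bar> / ennreal ((1 + norm x) powr \<sigma>) \<partial>lebesgue) < \<infinity>" (is "?I < _")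
    using assms(6) by blast
  obtain \<theta> where \<theta>: "0 \<le> \<theta>" and decay: "\<And>R. 0 \<le> R \<Longrightarrow>
      \<exists>K>0. \<forall>x. maximal \<rho> \<phi> \<theta> (indicator (ball 0 R)) x \<le> ennreal (K / (1 + norm x) powr \<sigma>)"
    using maximal_indicator_ball_decay[OF assms(1) \<phi> \<sigma>] by blast
  \<comment> \<open>\<theta> depends on \<rho> and \<sigma> but not on the ball, so \<open>C\<close>
    is fixed before \<open>R\<close> and \<open>l\<close> and serves all weights.\<close>
  obtain C where C: "0 < C" and TC: "\<And>w l. weight w \<Longrightarrow> 0 < l \<Longrightarrow>
      weight_measure w {x. ereal l < \<bar>T f x\<bar>} \<le>
        ennreal (C / l) * (\<integral>\<^sup>+x. e2ennreal \<bar>f x\<bar> * maximal \<rho> \<phi> \<theta> w x \<partial>lebesgue)"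
    using T[OF \<theta>] assms(5) by blast
  have "weak_L1_loc (T f)"
  proof (rule weak_L1_locI)
    show "T f \<in> borel_measurable lebesgue" by measurable
    fix R :: real assume "0 \<le> R"
    then obtain K where K: "0 < K"
      and max: "\<And>x. maximal \<rho> \<phi> \<theta> (indicator (ball 0 R)) x \<le> ennreal (K / (1 + norm x) powr \<sigma>)"
      using decay by blast
    have "(\<integral>\<^sup>+x. e2ennreal \<bar>f x\<bar> * maximal \<rho> \<phi> \<theta> (indicator (ball 0 R)) x \<partial>lebesgue)
        \<le> (\<integral>\<^sup>+x. ennreal K * (e2ennreal \<bar>f x\<bar> / ennreal ((1 + norm x) powr \<sigma>)) \<partial>lebesgue)"
    proof (intro nn_integral_mono)
      fix x :: "real ^ 'd"
      have "0 < (1 + norm x) powr \<sigma>" using norm_ge_zero[of x] by (simp del: norm_ge_zero)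
      then have "ennreal (K / (1 + norm x) powr \<sigma>) = ennreal K / ennreal ((1 + norm x) powr \<sigma>)"
        using K by (simp add: divide_ennreal)
      then have "e2ennreal \<bar>f x\<bar> * maximal \<rho> \<phi> \<theta> (indicator (ball 0 R)) x
          \<le> e2ennreal \<bar>f x\<bar> * (ennreal K / ennreal ((1 + norm x) powr \<sigma>))"
        using max[of x] by (intro mult_left_mono) auto
      then show "e2ennreal \<bar>f x\<bar> * maximal \<rho> \<phi> \<theta> (indicator (ball 0 R)) x
          \<le> ennreal K * (e2ennreal \<bar>f x\<bar> / ennreal ((1 + norm x) powr \<sigma>))"
        by (simp add: divide_ennreal_def mult_ac)
    qed
    also have "\<dots> = ennreal K * ?I"
      by (intro nn_integral_cmult) measurable
    finally have int: "(\<integral>\<^sup>+x. e2ennreal \<bar>f x\<bar> * maximal \<rho> \<phi> \<theta> (indicator (ball 0 R)) x \<partial>lebesgue)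
      \<le> ennreal K * ?I" .
    have "ennreal l * emeasure lebesgue {x \<in> ball 0 R. ereal l < \<bar>T f x\<bar>} \<le> ennreal C * (ennreal K * ?I)"
      if "0 < l" for l
    proof -
      have meas: "{x. ereal l < \<bar>T f x\<bar>} \<in> sets lebesgue"
        using measurable_sets[of "\<lambda>x. \<bar>T f x\<bar>" lebesgue borel "{ereal l<..}"]
        by (simp add: vimage_def)
      \<comment> \<open>With the indicator as weight, the weighted measure of the full superlevel
        set is the Lebesgue measure of its part in the ball.\<close>
      have "emeasure lebesgue {x \<in> ball 0 R. ereal l < \<bar>T f x\<bar>}
          = weight_measure (indicator (ball 0 R)) {x. ereal l < \<bar>T f x\<bar>}"
        using meas by (subst weight_measure_indicator) (auto simp: Int_def)
      also have "\<dots> \<le> ennreal (C / l) * (ennreal K * ?I)"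
        by (rule order_trans[OF TC[OF weight_indicator_ball that] mult_left_mono[OF int]]) simp
      finally have "ennreal l * emeasure lebesgue {x \<in> ball 0 R. ereal l < \<bar>T f x\<bar>}
          \<le> ennreal l * (ennreal (C / l) * (ennreal K * ?I))"
        by (intro mult_left_mono) auto
      \<comment> \<open>The factor \<open>l\<close> cancels, which makes the bound uniform in
        \<open>l\<close>.\<close>
      also have "\<dots> = ennreal C * (ennreal K * ?I)"
        using that C by (simp add: mult.assoc[symmetric] ennreal_mult[symmetric])
      finally show ?thesis .
    qed
    moreover have "ennreal C * (ennreal K * ?I) < \<infinity>"
      using fin by (simp add: ennreal_mult_less_top)
    ultimately show "\<exists>M<\<infinity>. \<forall>l>0. ennreal l * emeasure lebesgue {x \<in> ball 0 R. ereal l < \<bar>T f x\<bar>} \<le> M"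
      by blast
  qed
  then show ?thesis using weak_L1_loc_finite_AE by blast
qed

end
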